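(* For $i=1,2$, let $G_i$ be a finite group of order $n_i\ge 2$, and suppose there exists a half-set $(s_i,t_i)$-$\lambda_i$-fold near-factorization of $G_i$. Then there exists a half-set $(s,t)$-$\lambda$-fold near-factorization of $G_1\times G_2$, where $s=s_1s_2$, $\lambda=2\lambda_1\lambda_2$ and $t=(n_1n_2-1)/2$.
   Context: For subsets $S,T$ of a finite group $G$ with identity $e$, and a positive integer $\lambda$, $(S,T)$ is an $(s,t)$-$\lambda$-fold near-factorization of $G$ if $|S|=s$, $|T|=t$, every non-identity element of $G$ can be written as $xy$ with $x\in S$, $y\in T$ in exactly $\lambda$ ways, and $xy\neq e$ for all $x\in S$, $y\in T$. It is a half-set near-factorization if $t=(|G|-1)/2$ (so $|G|$ is odd). *)

theory Defs
  imports Complex_Main "HOL-Algebra.Group" "HOL-Algebra.Coset"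
begin

definition near_factorization ::
  "('a, 'm) monoid_scheme \<Rightarrow> nat \<Rightarrow> nat \<Rightarrow> nat \<Rightarrow> 'a set \<Rightarrow> 'a set \<Rightarrow> bool" where
  "near_factorization G s t l S T \<longleftrightarrow>
     l > 0 \<and> S \<subseteq> carrier G \<and> T \<subseteq> carrier G \<and> card S = s \<and> card T = t \<and>
     (\<forall>g \<in> carrier G. g \<noteq> \<one>\<^bsub>G\<^esub> \<longrightarrow>
        card {(x, y). x \<in> S \<and> y \<in> T \<and> x \<otimes>\<^bsub>G\<^esub> y = g} = l) \<and>
     (\<forall>x \<in> S. \<forall>y \<in> T. x \<otimes>\<^bsub>G\<^esub> y \<noteq> \<one>\<^bsub>G\<^esub>)"

(* The size condition is stated over the reals so that neither truncated subtraction
   nor rounding division is involved; it forces the order of G to be odd. *)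
definition half_set_near_factorization ::
  "('a, 'm) monoid_scheme \<Rightarrow> nat \<Rightarrow> nat \<Rightarrow> nat \<Rightarrow> 'a set \<Rightarrow> 'a set \<Rightarrow> bool" where
  "half_set_near_factorization G s t l S T \<longleftrightarrow>
     near_factorization G s t l S T \<and> real t = (real (order G) - 1) / 2"

end

theory Submission
  imports Defs
begin

text \<open>In the integral group ring, put \<open>A\<^sub>i = G\<^sub>i - 2 T\<^sub>i\<close>, an element with coefficients \<open>\<plusminus>1\<close>.
  Double counting gives \<open>s\<^sub>i = 2 \<lambda>\<^sub>i\<close>, so \<open>S\<^sub>i T\<^sub>i = \<lambda>\<^sub>i (G\<^sub>i - e)\<close> is equivalent to
  \<open>S\<^sub>i A\<^sub>i = s\<^sub>i e\<close>. This is multiplicative: with \<open>S = S\<^sub>1 \<times> S\<^sub>2\<close> and \<open>A = A\<^sub>1 \<otimes> A\<^sub>2\<close> one has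
  \<open>S A = s\<^sub>1 s\<^sub>2 e\<close>, and \<open>T = (G - A) / 2\<close> is the set where exactly one of the two coordinates
  lies in \<open>T\<^sub>i\<close>.\<close>

text \<open>In a group, \<open>x\<close> and \<open>g\<close> determine \<open>y\<close>. Counting
  over \<open>S\<close> alone turns factorizations into a membership predicate on one factor, which
  is what combines well in a direct product.\<close>

lemma (in group) card_factorizations:
  assumes "S \<subseteq> carrier G" and "T \<subseteq> carrier G" and "g \<in> carrier G"
  shows "card {(x, y). x \<in> S \<and> y \<in> T \<and> x \<otimes> y = g} = card {x \<in> S. inv x \<otimes> g \<in> T}"
proof (rule bij_betw_same_card[of fst])
  have sol: "x \<otimes> y = g \<longleftrightarrow> y = inv x \<otimes> g" if "x \<in> S" "y \<in> T" for x y
    using that assms by (metis inv_solve_left subsetD)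
  have "{(x, y). x \<in> S \<and> y \<in> T \<and> x \<otimes> y = g} = {(x, y). x \<in> S \<and> y \<in> T \<and> y = inv x \<otimes> g}"
    using sol by (simp cong: conj_cong)
  also have "\<dots> = (\<lambda>x. (x, inv x \<otimes> g)) ` {x \<in> S. inv x \<otimes> g \<in> T}"
    by auto
  finally have "{(x, y). x \<in> S \<and> y \<in> T \<and> x \<otimes> y = g}
    = (\<lambda>x. (x, inv x \<otimes> g)) ` {x \<in> S. inv x \<otimes> g \<in> T}" .
  then show "bij_betw fst {(x, y). x \<in> S \<and> y \<in> T \<and> x \<otimes> y = g} {x \<in> S. inv x \<otimes> g \<in> T}"
    by (auto simp: bij_betw_def inj_on_def image_image)
qed

text \<open>Avoiding the identity means that its fibre has size 0, so both clauses of the definition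
  merge into one fibre count with two possible values.\<close>

lemma (in group) near_factorization_iff:
  assumes "finite (carrier G)"
  shows "near_factorization G s t l S T \<longleftrightarrow>
    l > 0 \<and> S \<subseteq> carrier G \<and> T \<subseteq> carrier G \<and> card S = s \<and> card T = t \<and>
    (\<forall>g \<in> carrier G. card {x \<in> S. inv x \<otimes> g \<in> T} = (if g = \<one> then 0 else l))"
proof (cases "S \<subseteq> carrier G \<and> T \<subseteq> carrier G")
  case True
  then have S: "S \<subseteq> carrier G" and T: "T \<subseteq> carrier G" by auto
  have "finite S" using S assms by (rule finite_subset)
  have "x \<otimes> y = \<one> \<longleftrightarrow> y = inv x \<otimes> \<one>" if "x \<in> S" "y \<in> T" for x y
    using that S T by (metis inv_solve_left one_closed subsetD)
  then have "(\<forall>x \<in> S. \<forall>y \<in> T. x \<otimes> y \<noteq> \<one>) \<longleftrightarrow> {x \<in> S. inv x \<otimes> \<one> \<in> T} = {}"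
    by blast
  also have "\<dots> \<longleftrightarrow> card {x \<in> S. inv x \<otimes> \<one> \<in> T} = 0"
    \<comment> \<open>Finiteness matters here: \<open>card\<close> is also 0 on infinite
      sets.\<close>
    using \<open>finite S\<close> by simp
  finally show ?thesis
    unfolding near_factorization_def using card_factorizations[OF S T] by auto
qed (auto simp: near_factorization_def)

lemma (in group) near_factorization_card:
  assumes fin: "finite (carrier G)" and nf: "near_factorization G s t l S T"
  shows "s * t = l * (order G - 1)"
proof -
  have S: "S \<subseteq> carrier G" and T: "T \<subseteq> carrier G" and "card S = s" and "card T = t"
    and fib: "\<And>g. g \<in> carrier G \<Longrightarrow> g \<noteq> \<one> \<Longrightarrow>
      card {(x, y). x \<in> S \<and> y \<in> T \<and> x \<otimes> y = g} = l"
    and ne: "\<And>x y. x \<in> S \<Longrightarrow> y \<in> T \<Longrightarrow> x \<otimes> y \<noteq> \<one>"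
    using nf unfolding near_factorization_def by auto
  \<comment> \<open>Double counting: the pairs are sorted by their product, and the fibre over the
    identity is empty.\<close>
  have "S \<times> T = (\<Union>g \<in> carrier G - {\<one>}. {(x, y). x \<in> S \<and> y \<in> T \<and> x \<otimes> y = g})"
    using S T ne by (auto simp: subset_iff)
  moreover have "finite (S \<times> T)"
    using S T fin by (meson finite_SigmaI finite_subset)
  then have "finite {(x, y). x \<in> S \<and> y \<in> T \<and> x \<otimes> y = g}" for g
    by (rule rev_finite_subset) auto
  ultimately have "card (S \<times> T)
      = (\<Sum>g \<in> carrier G - {\<one>}. card {(x, y). x \<in> S \<and> y \<in> T \<and> x \<otimes> y = g})"
    using fin by (auto intro!: card_UN_disjoint)
  also have "\<dots> = l * (order G - 1)"
    using fib fin by (simp add: order_def card_Diff_singleton)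
  finally show ?thesis
    using \<open>card S = s\<close> \<open>card T = t\<close> by (simp add: card_cartesian_product)
qed

lemma (in group) half_set_near_factorization_card:
  assumes "finite (carrier G)" and "order G \<ge> 2"
    and hs: "half_set_near_factorization G s t l S T"
  shows "order G = 2 * t + 1" and "s = 2 * l"
proof -
  show ord: "order G = 2 * t + 1"
    using hs unfolding half_set_near_factorization_def by (simp add: field_simps)
  have "s * t = l * (order G - 1)"
    using near_factorization_card assms unfolding half_set_near_factorization_def by blast
  \<comment> \<open>Since \<open>order G - 1 = 2 * t\<close>, the double count reads
    \<open>s * t = l * (2 * t)\<close>; order at least 2 gives \<open>t > 0\<close>, so
    \<open>t\<close> cancels.\<close>
  then show "s = 2 * l"
    using ord assms(2) by simp
qed

text \<open>Serves twice below: on the two carriers it gives the size of the new \<open>T\<close>,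
  and on \<open>S1\<close> and \<open>S2\<close> the fibre counts in the product.\<close>

lemma card_exactly_one:
  assumes "finite A" and "finite B"
  shows "card {(x, y) \<in> A \<times> B. P x \<noteq> Q y}
    = card {x \<in> A. P x} * (card B - card {y \<in> B. Q y})
      + (card A - card {x \<in> A. P x}) * card {y \<in> B. Q y}"
proof -
  have "{(x, y) \<in> A \<times> B. P x \<noteq> Q y}
      = {x \<in> A. P x} \<times> (B - {y \<in> B. Q y}) \<union> (A - {x \<in> A. P x}) \<times> {y \<in> B. Q y}"
    by auto
  then show ?thesis
    using assms by (simp add: card_Un_disjoint card_cartesian_product card_Diff_subset disjoint_iff)
qed

lemma half_set_near_factorization_DirProd:
  assumes "group G" and finG: "finite (carrier G)" and "order G \<ge> 2"
    and "group H" and finH: "finite (carrier H)" and "order H \<ge> 2"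
    and hsG: "half_set_near_factorization G s1 t1 l1 S1 T1"
    and hsH: "half_set_near_factorization H s2 t2 l2 S2 T2"
  shows "half_set_near_factorization (G \<times>\<times> H) (s1 * s2) ((order G * order H - 1) div 2)
    (2 * l1 * l2) (S1 \<times> S2)
    {(x, y) \<in> carrier G \<times> carrier H. (x \<in> T1) \<noteq> (y \<in> T2)}"
    (is "half_set_near_factorization _ _ _ _ ?S ?T")
proof -
  interpret G: group G by fact
  interpret H: group H by fact
  interpret GH: group "G \<times>\<times> H" by (rule DirProd_group) fact+
  have finGH: "finite (carrier (G \<times>\<times> H))" using finG finH by simp
  note ordG = G.half_set_near_factorization_card[OF finG assms(3) hsG]
  note ordH = H.half_set_near_factorization_card[OF finH assms(6) hsH]
  have ordGH: "order (G \<times>\<times> H) = order G * order H"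
    by (simp add: order_def card_cartesian_product)
  have "l1 > 0" and S1: "S1 \<subseteq> carrier G" and T1: "T1 \<subseteq> carrier G" and "card S1 = s1" and "card T1 = t1"
    and c1: "\<And>g. g \<in> carrier G \<Longrightarrow> card {x \<in> S1. inv\<^bsub>G\<^esub> x \<otimes>\<^bsub>G\<^esub> g \<in> T1} = (if g = \<one>\<^bsub>G\<^esub> then 0 else l1)"
    using hsG unfolding half_set_near_factorization_def G.near_factorization_iff[OF finG] by auto
  have "l2 > 0" and S2: "S2 \<subseteq> carrier H" and T2: "T2 \<subseteq> carrier H" and "card S2 = s2" and "card T2 = t2"
    and c2: "\<And>h. h \<in> carrier H \<Longrightarrow> card {y \<in> S2. inv\<^bsub>H\<^esub> y \<otimes>\<^bsub>H\<^esub> h \<in> T2} = (if h = \<one>\<^bsub>H\<^esub> then 0 else l2)"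
    using hsH unfolding half_set_near_factorization_def H.near_factorization_iff[OF finH] by auto
  have finS: "finite S1" "finite S2"
    using S1 S2 finG finH by (auto intro: finite_subset)
  have "{x \<in> carrier G. x \<in> T1} = T1" "{y \<in> carrier H. y \<in> T2} = T2"
    using T1 T2 by auto
  then have "card ?T = t1 * (order H - t2) + (order G - t1) * t2"
    using card_exactly_one[OF finG finH, of "\<lambda>x. x \<in> T1" "\<lambda>y. y \<in> T2"] \<open>card T1 = t1\<close> \<open>card T2 = t2\<close>
    by (simp add: order_def)
  \<comment> \<open>With orders \<open>2 * t1 + 1\<close> and \<open>2 * t2 + 1\<close>, both sides
    equal \<open>2 * t1 * t2 + t1 + t2\<close>.\<close>
  also have "\<dots> = (order G * order H - 1) div 2"
    by (simp add: ordG(1) ordH(1) algebra_simps)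
  finally have cardT: "card ?T = (order G * order H - 1) div 2" .
  \<comment> \<open>A product of odd orders is odd, so \<open>div 2\<close> is exact.\<close>
  have half: "real ((order G * order H - 1) div 2) = (real (order (G \<times>\<times> H)) - 1) / 2"
    by (simp add: ordGH ordG(1) ordH(1) algebra_simps)
  have count: "card {p \<in> ?S. inv\<^bsub>G \<times>\<times> H\<^esub> p \<otimes>\<^bsub>G \<times>\<times> H\<^esub> (g, h) \<in> ?T}
      = (if (g, h) = \<one>\<^bsub>G \<times>\<times> H\<^esub> then 0 else 2 * l1 * l2)"
    if g: "g \<in> carrier G" and h: "h \<in> carrier H" for g h
  proof -
    have "{p \<in> ?S. inv\<^bsub>G \<times>\<times> H\<^esub> p \<otimes>\<^bsub>G \<times>\<times> H\<^esub> (g, h) \<in> ?T}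
        = {(x, y) \<in> S1 \<times> S2. (inv\<^bsub>G\<^esub> x \<otimes>\<^bsub>G\<^esub> g \<in> T1) \<noteq> (inv\<^bsub>H\<^esub> y \<otimes>\<^bsub>H\<^esub> h \<in> T2)}"
      using g h S1 S2 \<open>group G\<close> \<open>group H\<close> by (auto simp: subset_iff)
    \<comment> \<open>Let \<open>a\<close> and \<open>b\<close> be the two coordinate counts, so
      \<open>a\<close> is 0 or \<open>l1\<close> and \<open>b\<close> is 0 or \<open>l2\<close>. The
      total is \<open>a * (2 * l2 - b) + (2 * l1 - a) * b\<close>: it vanishes for
      \<open>a = b = 0\<close> and is \<open>2 * l1 * l2\<close> in the other three cases. This is
      where \<open>s1 = 2 * l1\<close> and \<open>s2 = 2 * l2\<close> are essential.\<close>
    then show ?thesis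
      using card_exactly_one[OF finS, of "\<lambda>x. inv\<^bsub>G\<^esub> x \<otimes>\<^bsub>G\<^esub> g \<in> T1" "\<lambda>y. inv\<^bsub>H\<^esub> y \<otimes>\<^bsub>H\<^esub> h \<in> T2"]
      by (simp add: c1[OF g] c2[OF h] \<open>card S1 = s1\<close> \<open>card S2 = s2\<close> ordG(2) ordH(2))
  qed
  have "?S \<subseteq> carrier (G \<times>\<times> H)" "?T \<subseteq> carrier (G \<times>\<times> H)" using S1 S2 by auto
  moreover have "card ?S = s1 * s2"
    by (simp add: card_cartesian_product \<open>card S1 = s1\<close> \<open>card S2 = s2\<close>)
  ultimately show ?thesis
    unfolding half_set_near_factorization_def GH.near_factorization_iff[OF finGH]
    \<comment> \<open>The two rewrite rules are disabled so that product and identity keep the form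
      in which \<open>count\<close> states them.\<close>
    using count cardT half \<open>l1 > 0\<close> \<open>l2 > 0\<close> by (auto simp del: mult_DirProd one_DirProd)
qed

theorem theorem2p19:
  fixes G1 :: "('a, 'm) monoid_scheme" and G2 :: "('b, 'k) monoid_scheme"
    and n1 n2 s1 s2 t1 t2 l1 l2 s t l :: nat
  assumes "group G1" and "finite (carrier G1)" and "order G1 = n1" and "n1 \<ge> 2"
    and "group G2" and "finite (carrier G2)" and "order G2 = n2" and "n2 \<ge> 2"
    and "\<exists>S1 T1. half_set_near_factorization G1 s1 t1 l1 S1 T1"
    and "\<exists>S2 T2. half_set_near_factorization G2 s2 t2 l2 S2 T2"
    and "s = s1 * s2" and "l = 2 * l1 * l2" and "t = (n1 * n2 - 1) div 2"
  shows "\<exists>S T. half_set_near_factorization (G1 \<times>\<times> G2) s t l S T"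
  using assms half_set_near_factorization_DirProd[of G1 G2] by blast

end
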